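(* Let $(X,d)$ be a finite metric space with canonical graph $(X,E)$. A directed subgraph of $(X,E)$ with at least one edge is the downhill graph for some $1$-Lipschitz function on $X$ if and only if it is the directed graph of some non-zero transportation problem $f\in\mathrm{TP}(X)$.
   Context: Let $(X,d)$ be a finite metric space. $\mathrm{TP}(X)$ is the real vector space of functions $f:X\to\mathbb{R}$ with $\sum_{v\in X} f(v)=0$ (transportation problems). Canonical graph: take the complete graph on $X$ with edge $uv$ weighted by $d(u,v)$, and delete every edge $uv$ for which there is $w\notin\{u,v\}$ with $d(u,w)+d(w,v)=d(u,v)$. The result is the canonical graph $(X,E)$; its weighted graph distance equals $d$. A directed subgraph of $(X,E)$ is given by a subset of $E$ together with a choice of direction for each edge of the subset (directed subgraphs are compared by their sets of directed edges). Fix an arbitrary reference orientation of $E$, so each edge $e$ has a tail and a head. A roadmap is a function $p:E\to\mathbb{R}$; its cost is $\|p\|_{1,d}=\sum_{uv\in E}|p(uv)|\,d(u,v)$. It is a roadmap for $f\in\mathrm{TP}(X)$ if $f(v)=\sum_{\mathrm{tail}(e)=v}p(e)-\sum_{\mathrm{head}(e)=v}p(e)$ for all $v\in X$. A roadmap for $f$ is optimal if it has minimal cost among all roadmaps for $f$. Two optimal roadmaps for $f$ never have opposite signs on an edge, and there is an optimal roadmap $p$ for $f$ whose support $\{e:p(e)\ne0\}$ contains the supports of all optimal roadmaps for $f$. The directed graph of $f$ consists of the edges in the support of such a $p$, where an edge $e$ has the reference orientation if $p(e)>0$ and the opposite orientation if $p(e)<0$ (this does not depend on the choice of $p$). For a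 $1$-Lipschitz function $l:X\to\mathbb{R}$, the downhill graph for $l$ is the directed graph consisting of all edges $uv\in E$ with $|l(u)-l(v)|=d(u,v)$, each directed from the vertex where $l$ is larger to the vertex where $l$ is smaller. *)

theory Defs
  imports "HOL-Analysis.Abstract_Metric_Spaces"
begin

text \<open>
  A finite metric space is a finite carrier set X together with d such that the library predicate
  \<^const>\<open>Metric_space\<close> holds.  Functions on X, and functions on a set E of edges, are
  total functions of which only the values on X, respectively E, are used.
\<close>

definition TP :: "'a set \<Rightarrow> ('a \<Rightarrow> real) set" where
  "TP X = {f. (\<Sum>v\<in>X. f v) = 0}"

definition canonical_edges :: "'a set \<Rightarrow> ('a \<Rightarrow> 'a \<Rightarrow> real) \<Rightarrow> 'a set set" where
  "canonical_edges X d =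
     {{u, v} | u v. u \<in> X \<and> v \<in> X \<and> u \<noteq> v \<and>
        \<not> (\<exists>w\<in>X. w \<notin> {u, v} \<and> d u w + d w v = d u v)}"

text \<open>
  A directed subgraph is represented by its set of directed edges, the pair (u, v) being the
  edge directed from u to v; each edge is used in at most one direction.
\<close>

definition directed_subgraph :: "'a set set \<Rightarrow> ('a \<times> 'a) set \<Rightarrow> bool" where
  "directed_subgraph E D \<longleftrightarrow>
     (\<forall>u v. (u, v) \<in> D \<longrightarrow> {u, v} \<in> E \<and> (v, u) \<notin> D)"

text \<open>Edges in a canonical graph have two distinct endpoints, so the tail and head below differ.\<close>

definition orientation :: "'a set set \<Rightarrow> ('a set \<Rightarrow> 'a) \<Rightarrow> ('a set \<Rightarrow> 'a) \<Rightarrow> bool" where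
  "orientation E tail head \<longleftrightarrow> (\<forall>e\<in>E. e = {tail e, head e})"

text \<open>
  In the definitions below, \<open>tail\<close> and \<open>head\<close> are the reference orientation of the
  canonical graph.
\<close>

definition roadmap_cost ::
  "'a set \<Rightarrow> ('a \<Rightarrow> 'a \<Rightarrow> real) \<Rightarrow> ('a set \<Rightarrow> 'a) \<Rightarrow> ('a set \<Rightarrow> 'a) \<Rightarrow> ('a set \<Rightarrow> real) \<Rightarrow> real" where
  "roadmap_cost X d tail head p =
     (\<Sum>e\<in>canonical_edges X d. \<bar>p e\<bar> * d (tail e) (head e))"

definition roadmap_for ::
  "'a set \<Rightarrow> ('a \<Rightarrow> 'a \<Rightarrow> real) \<Rightarrow> ('a set \<Rightarrow> 'a) \<Rightarrow> ('a set \<Rightarrow> 'a) \<Rightarrow> ('a \<Rightarrow> real) \<Rightarrow>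
    ('a set \<Rightarrow> real) \<Rightarrow> bool" where
  "roadmap_for X d tail head f p \<longleftrightarrow>
     (\<forall>v\<in>X. f v = (\<Sum>e\<in>{e \<in> canonical_edges X d. tail e = v}. p e)
                - (\<Sum>e\<in>{e \<in> canonical_edges X d. head e = v}. p e))"

definition optimal_roadmap_for ::
  "'a set \<Rightarrow> ('a \<Rightarrow> 'a \<Rightarrow> real) \<Rightarrow> ('a set \<Rightarrow> 'a) \<Rightarrow> ('a set \<Rightarrow> 'a) \<Rightarrow> ('a \<Rightarrow> real) \<Rightarrow>
    ('a set \<Rightarrow> real) \<Rightarrow> bool" where
  "optimal_roadmap_for X d tail head f p \<longleftrightarrow>
     roadmap_for X d tail head f p \<and>
     (\<forall>q. roadmap_for X d tail head f q \<longrightarrow>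
        roadmap_cost X d tail head p \<le> roadmap_cost X d tail head q)"

definition roadmap_support :: "'a set \<Rightarrow> ('a \<Rightarrow> 'a \<Rightarrow> real) \<Rightarrow> ('a set \<Rightarrow> real) \<Rightarrow> 'a set set" where
  "roadmap_support X d p = {e \<in> canonical_edges X d. p e \<noteq> 0}"

definition directed_support ::
  "'a set \<Rightarrow> ('a \<Rightarrow> 'a \<Rightarrow> real) \<Rightarrow> ('a set \<Rightarrow> 'a) \<Rightarrow> ('a set \<Rightarrow> 'a) \<Rightarrow> ('a set \<Rightarrow> real) \<Rightarrow>
    ('a \<times> 'a) set" where
  "directed_support X d tail head p =
     {(tail e, head e) | e. e \<in> roadmap_support X d p \<and> p e > 0} \<union>
     {(head e, tail e) | e. e \<in> roadmap_support X d p \<and> p e < 0}"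

text \<open>
  The directed graph of f does not depend on the choice of an optimal roadmap p of maximal
  support; it is rendered as the relation ``D is the directed graph of f''.
\<close>

definition is_directed_graph_of ::
  "'a set \<Rightarrow> ('a \<Rightarrow> 'a \<Rightarrow> real) \<Rightarrow> ('a set \<Rightarrow> 'a) \<Rightarrow> ('a set \<Rightarrow> 'a) \<Rightarrow> ('a \<Rightarrow> real) \<Rightarrow>
    ('a \<times> 'a) set \<Rightarrow> bool" where
  "is_directed_graph_of X d tail head f D \<longleftrightarrow>
     (\<exists>p. optimal_roadmap_for X d tail head f p \<and>
          (\<forall>q. optimal_roadmap_for X d tail head f q \<longrightarrow>
             roadmap_support X d q \<subseteq> roadmap_support X d p) \<and>
          D = directed_support X d tail head p)"

definition one_Lipschitz :: "'a set \<Rightarrow> ('a \<Rightarrow> 'a \<Rightarrow> real) \<Rightarrow> ('a \<Rightarrow> real) \<Rightarrow> bool" where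
  "one_Lipschitz X d l \<longleftrightarrow> (\<forall>u\<in>X. \<forall>v\<in>X. \<bar>l u - l v\<bar> \<le> d u v)"

definition downhill_graph ::
  "'a set \<Rightarrow> ('a \<Rightarrow> 'a \<Rightarrow> real) \<Rightarrow> ('a \<Rightarrow> real) \<Rightarrow> ('a \<times> 'a) set" where
  "downhill_graph X d l =
     {(u, v). {u, v} \<in> canonical_edges X d \<and> \<bar>l u - l v\<bar> = d u v \<and> l u > l v}"

end

theory Submission imports Defs
begin

text \<open>
  The theorem is linear programming duality with strict complementary slackness: roadmaps are the
  primal solutions of a transportation problem, 1-Lipschitz functions the dual ones.

  For any roadmap q of f and any 1-Lipschitz l, summation by parts turns the sum of f v * l v into
  the sum over the edges of q times the drop of l, which is at most the cost of q, with equality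
  iff q runs only along downhill edges of l, in the downhill direction.  So if D is the downhill
  graph of l, the roadmap sending one unit along each edge of D is optimal for the f it produces,
  and every other optimal roadmap lives on D as well
  (\<open>downhill_graph_is_directed_graph\<close>).

  Conversely let p be an optimal roadmap of maximal support and D its directed graph.  Rerouting p
  by a small multiple of a circulation q changes the cost at the rate \<open>cost_deriv p q\<close>, so this
  is never negative; and it is positive as soon as q uses an edge outside the support of p, since
  otherwise the rerouted roadmap would be optimal with a larger support.  Give the pair (u, v) the
  residual cost d u v, or -(d u v) if (v, u) is in D, in which case moving from u to v cancels flow
  of p.  Closed walks carry circulations (\<open>flow_along_walk\<close>), hence have nonnegative residual
  cost, and even positive cost if they traverse an edge outside the support.
  Shortest-walk distances, averaged over all targets, then form
  a potential l with l u - l v at most the residual cost, strictly so on edges outside the support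
  (\<open>strict_potential_exists\<close>).  For pairs (v, u) of D the two bounds in opposite
  directions force l v - l u = d v u, and strictness keeps all other edges from being downhill.
\<close>

section \<open>Potentials from shortest walks\<close>

fun walk_cost :: "('a \<Rightarrow> 'a \<Rightarrow> real) \<Rightarrow> 'a list \<Rightarrow> real" where
  "walk_cost c (x # y # zs) = c x y + walk_cost c (y # zs)"
| "walk_cost c _ = 0"

text \<open>
  Walks may step between any two points of X, so that any two points are joined by one; steps that
  are not edges become flows along edges by \<open>flow_between\<close>.
\<close>

definition walks :: "'a set \<Rightarrow> 'a \<Rightarrow> 'a \<Rightarrow> 'a list set" where
  "walks X u v = {xs. xs \<noteq> [] \<and> set xs \<subseteq> X \<and> hd xs = u \<and> last xs = v}"

text \<open>
  The minimum ranges over distinct lists because there are finitely many of them; when no closed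
  walk has negative cost, repeating a vertex cannot make a walk cheaper.
\<close>

definition walk_dist :: "'a set \<Rightarrow> ('a \<Rightarrow> 'a \<Rightarrow> real) \<Rightarrow> 'a \<Rightarrow> 'a \<Rightarrow> real" where
  "walk_dist X c u v = Min (walk_cost c ` {xs \<in> walks X u v. distinct xs})"

lemma walk_cost_split:
  "walk_cost c (xs @ u # ys) = walk_cost c (xs @ [u]) + walk_cost c (u # ys)"
  by (induction c xs rule: walk_cost.induct) simp_all

lemma walk_cost_Cons:
  "xs \<noteq> [] \<Longrightarrow> walk_cost c (u # xs) = c u (hd xs) + walk_cost c xs"
  by (cases xs) auto

lemma finite_distinct_walks:
  assumes "finite X"
  shows "finite {xs \<in> walks X u v. distinct xs}"
  by (rule finite_subset[OF _ finite_subset_distinct[OF assms]]) (auto simp: walks_def)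

lemma walk_dist_le:
  assumes "finite X" "xs \<in> walks X u v" "distinct xs"
  shows "walk_dist X c u v \<le> walk_cost c xs"
  unfolding walk_dist_def using assms finite_distinct_walks[of X u v] by (intro Min_le) auto

lemma walk_dist_attained:
  assumes "finite X" "u \<in> X" "v \<in> X"
  obtains xs where "xs \<in> walks X u v" "distinct xs" "walk_dist X c u v = walk_cost c xs"
proof -
  have "(if u = v then [u] else [u, v]) \<in> {xs \<in> walks X u v. distinct xs}"
    using assms by (auto simp: walks_def)
  then have "walk_dist X c u v \<in> walk_cost c ` {xs \<in> walks X u v. distinct xs}"
    unfolding walk_dist_def using finite_distinct_walks[OF assms(1), of u v]
    by (intro Min_in) blast+
  then show thesis using that by auto
qed

text \<open>
  Prepending u to a shortest walk from v gives a walk from u.  If it revisits u, cutting out the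
  closed walk up to that visit does not increase the cost and restores distinctness.
\<close>

lemma walk_dist_triangle:
  assumes "finite X"
    and nonneg: "\<And>u xs. xs \<in> walks X u u \<Longrightarrow> 0 \<le> walk_cost c xs"
    and "u \<in> X" "v \<in> X" "r \<in> X"
  shows "walk_dist X c u r \<le> c u v + walk_dist X c v r"
proof -
  obtain xs where xs: "xs \<in> walks X v r" "distinct xs" "walk_dist X c v r = walk_cost c xs"
    using walk_dist_attained assms by metis
  have cost: "walk_cost c (u # xs) = c u v + walk_cost c xs"
    using xs by (auto simp: walks_def walk_cost_Cons)
  show ?thesis
  proof (cases "u \<in> set xs")
    case False
    have "walk_dist X c u r \<le> walk_cost c (u # xs)"
      using xs False assms by (intro walk_dist_le) (auto simp: walks_def)
    then show ?thesis using cost xs by simp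
  next
    case True
    then obtain as bs where split: "xs = as @ u # bs" by (meson split_list)
    have "walk_dist X c u r \<le> walk_cost c (u # bs)"
      using xs split assms by (intro walk_dist_le) (auto simp: walks_def)
    moreover have "0 \<le> walk_cost c (u # as @ [u])"
      using xs split assms by (intro nonneg[of _ u]) (auto simp: walks_def)
    moreover have "walk_cost c (u # xs) = walk_cost c (u # as @ [u]) + walk_cost c (u # bs)"
      using walk_cost_split[of c "u # as" u bs] split by simp
    ultimately show ?thesis using cost xs by simp
  qed
qed

lemma walk_dist_self:
  assumes "finite X" "r \<in> X"
  shows "walk_dist X c r r = 0"
proof -
  obtain xs where xs: "xs \<in> walks X r r" "distinct xs" "walk_dist X c r r = walk_cost c xs"
    using walk_dist_attained[OF assms assms(2)] by metis
  then have "xs = [r]"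
    by (cases xs) (auto simp: walks_def split: if_splits)
  then show ?thesis using xs by simp
qed

text \<open>
  The distance to a fixed r is a potential by the triangle inequality, and for r = u the bound is
  strict at every pair (u, v) in S: the distance from u to itself is 0, so equality would produce
  a closed walk through (u, v) of cost 0.  Averaging over r collects the strictness of all of them.
\<close>

lemma strict_potential_exists:
  assumes "finite X"
    and nonneg: "\<And>u xs. xs \<in> walks X u u \<Longrightarrow> 0 \<le> walk_cost c xs"
    and pos: "\<And>u v xs. (u, v) \<in> S \<Longrightarrow> xs \<in> walks X v u \<Longrightarrow> 0 < c u v + walk_cost c xs"
  obtains l where "\<And>u v. u \<in> X \<Longrightarrow> v \<in> X \<Longrightarrow> l u - l v \<le> c u v"
    and "\<And>u v. u \<in> X \<Longrightarrow> v \<in> X \<Longrightarrow> (u, v) \<in> S \<Longrightarrow> l u - l v < c u v"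
proof
  define l where "l x = (\<Sum>r\<in>X. walk_dist X c x r) / card X" for x
  have diff: "l u - l v = (\<Sum>r\<in>X. walk_dist X c u r - walk_dist X c v r) / card X" for u v
    by (simp add: l_def sum_subtractf diff_divide_distrib)
  have tri: "walk_dist X c u r - walk_dist X c v r \<le> c u v" if "u \<in> X" "v \<in> X" "r \<in> X" for u v r
    using walk_dist_triangle[OF assms(1), of c u v r] nonneg that by force
  fix u v assume uv: "u \<in> X" "v \<in> X"
  then have card: "card X > 0" using assms(1) card_gt_0_iff by blast
  have "(\<Sum>r\<in>X. walk_dist X c u r - walk_dist X c v r) \<le> (\<Sum>r\<in>X. c u v)"
    using tri uv by (intro sum_mono) auto
  then show "l u - l v \<le> c u v"
    using card by (simp add: diff pos_divide_le_eq mult.commute)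
  assume S: "(u, v) \<in> S"
  obtain xs where "xs \<in> walks X v u" "walk_dist X c v u = walk_cost c xs"
    using walk_dist_attained[OF assms(1) uv(2,1)] by metis
  then have "walk_dist X c u u - walk_dist X c v u < c u v"
    using pos[OF S] walk_dist_self[OF assms(1) uv(1)] by fastforce
  then have "(\<Sum>r\<in>X. walk_dist X c u r - walk_dist X c v r) < (\<Sum>r\<in>X. c u v)"
    using tri uv assms(1) by (intro sum_strict_mono_ex1) auto
  then show "l u - l v < c u v"
    using card by (simp add: diff pos_divide_less_eq mult.commute)
qed

section \<open>Flows on an oriented canonical graph\<close>

locale oriented_canonical_graph = Metric_space X d for X :: "'a set" and d +
  fixes tail head :: "'a set \<Rightarrow> 'a"
  assumes finite_X: "finite X"
    and orientation: "orientation (canonical_edges X d) tail head"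
begin

abbreviation E :: "'a set set" where "E \<equiv> canonical_edges X d"
abbreviation len :: "'a set \<Rightarrow> real" where "len e \<equiv> d (tail e) (head e)"

definition net :: "('a set \<Rightarrow> real) \<Rightarrow> 'a \<Rightarrow> real" where
  "net q v = (\<Sum>e\<in>{e \<in> E. tail e = v}. q e) - (\<Sum>e\<in>{e \<in> E. head e = v}. q e)"

text \<open>
  The one-sided derivative at 0 of the cost of p + t * q: the absolute value on an edge is
  differentiable where p is nonzero, and has slope \<open>\<bar>q e\<bar>\<close> to the right where p vanishes.
\<close>

definition cost_deriv :: "('a set \<Rightarrow> real) \<Rightarrow> ('a set \<Rightarrow> real) \<Rightarrow> real" where
  "cost_deriv p q = (\<Sum>e\<in>E. (if p e = 0 then \<bar>q e\<bar> else sgn (p e) * q e) * len e)"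

definition unit_flow :: "'a \<Rightarrow> 'a \<Rightarrow> 'a set \<Rightarrow> real" where
  "unit_flow u v e = (if e = {u, v} then (if tail e = u then 1 else -1) else 0)"

lemma roadmap_for_iff_net: "roadmap_for X d tail head f q \<longleftrightarrow> (\<forall>v\<in>X. f v = net q v)"
  by (simp add: roadmap_for_def net_def)

lemma finite_E: "finite E"
  by (rule finite_subset[of _ "Pow X"]) (auto simp: canonical_edges_def finite_X)

lemma edge_in_X: "{u, v} \<in> E \<Longrightarrow> u \<in> X \<and> v \<in> X \<and> u \<noteq> v"
  by (auto simp: canonical_edges_def doubleton_eq_iff)

lemma edge_eq: "e \<in> E \<Longrightarrow> e = {tail e, head e}"
  using orientation by (auto simp: orientation_def)

lemma edge_ends: "e \<in> E \<Longrightarrow> tail e \<in> X \<and> head e \<in> X \<and> tail e \<noteq> head e"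
  using edge_eq edge_in_X by metis

lemma edge_cases:
  assumes "{u, v} \<in> E"
  obtains "tail {u, v} = u" "head {u, v} = v" | "tail {u, v} = v" "head {u, v} = u"
  using edge_eq[OF assms] by (auto simp: doubleton_eq_iff)

lemma len_edge: "{u, v} \<in> E \<Longrightarrow> len {u, v} = d u v"
  by (erule edge_cases) (simp_all add: commute)

lemma len_pos: "e \<in> E \<Longrightarrow> 0 < len e"
  using edge_ends mdist_pos_less by blast

lemma net_add: "net (\<lambda>e. q e + r e) v = net q v + net r v"
  by (simp add: net_def sum.distrib)

lemma net_scale: "net (\<lambda>e. a * q e) v = a * net q v"
  by (simp add: net_def sum_distrib_left right_diff_distrib)

lemma net_eq: "net q v = (\<Sum>e\<in>E. q e * (of_bool (tail e = v) - of_bool (head e = v)))"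
proof -
  have "(\<Sum>e\<in>{e \<in> E. tail e = v}. q e) = (\<Sum>e\<in>E. q e * of_bool (tail e = v))"
       "(\<Sum>e\<in>{e \<in> E. head e = v}. q e) = (\<Sum>e\<in>E. q e * of_bool (head e = v))"
    using finite_E by (auto intro!: sum.mono_neutral_cong_left)
  then show ?thesis by (simp add: net_def right_diff_distrib sum_subtractf)
qed

text \<open>
  Summation by parts: the duality pairing between roadmaps and functions on X.
\<close>

lemma sum_net_mult: "(\<Sum>v\<in>X. net q v * l v) = (\<Sum>e\<in>E. q e * (l (tail e) - l (head e)))"
proof -
  have "(\<Sum>v\<in>X. net q v * l v)
      = (\<Sum>v\<in>X. \<Sum>e\<in>E. q e * (of_bool (tail e = v) * l v - of_bool (head e = v) * l v))"
    by (simp add: net_eq sum_distrib_right sum_distrib_left algebra_simps)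
  also have "\<dots> = (\<Sum>e\<in>E. q e * (\<Sum>v\<in>X. of_bool (tail e = v) * l v - of_bool (head e = v) * l v))"
    by (subst sum.swap) (simp add: sum_distrib_left)
  also have "\<dots> = (\<Sum>e\<in>E. q e * (l (tail e) - l (head e)))"
    using finite_X edge_ends
    by (intro sum.cong refl) (auto simp: sum_subtractf of_bool_def if_distrib[of "\<lambda>x. x * _"] cong: if_cong)
  finally show ?thesis .
qed

text \<open>
  The sign of \<open>unit_flow u v {u, v}\<close> records whether (u, v) agrees with the reference
  orientation, so the product on the right is the amount that p sends from u to v.  In this form
  the later arguments do not split on the orientation.
\<close>

lemma mem_directed_support_iff:
  assumes "{u, v} \<in> E"
  shows "(u, v) \<in> directed_support X d tail head p \<longleftrightarrow> unit_flow u v {u, v} * p {u, v} > 0"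
proof -
  have "u \<noteq> v" using edge_in_X assms by blast
  have "(u, v) \<in> directed_support X d tail head p \<longleftrightarrow>
      (tail {u, v} = u \<and> head {u, v} = v \<and> p {u, v} > 0) \<or>
      (head {u, v} = u \<and> tail {u, v} = v \<and> p {u, v} < 0)" (is "?L \<longleftrightarrow> ?R")
  proof
    assume ?L
    then obtain e where e: "e \<in> E"
      "(tail e = u \<and> head e = v \<and> p e > 0) \<or> (head e = u \<and> tail e = v \<and> p e < 0)"
      by (auto simp: directed_support_def roadmap_support_def)
    then have "e = {u, v}" using edge_eq[OF e(1)] by blast
    with e(2) show ?R by simp
  next
    assume ?R
    then show ?L
    proof
      assume "tail {u, v} = u \<and> head {u, v} = v \<and> p {u, v} > 0"
      then show ?thesis using assms
        by (auto simp: directed_support_def roadmap_support_def intro!: exI[of _ "{u, v}"])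
    next
      assume "head {u, v} = u \<and> tail {u, v} = v \<and> p {u, v} < 0"
      then show ?thesis using assms
        by (auto simp: directed_support_def roadmap_support_def intro!: exI[of _ "{u, v}"])
    qed
  qed
  with \<open>u \<noteq> v\<close> show ?thesis
    by (rule_tac edge_cases[OF assms]) (simp_all add: unit_flow_def)
qed

lemma mem_directed_support_edge:
  assumes "(u, v) \<in> directed_support X d tail head p"
  shows "{u, v} \<in> E"
proof -
  obtain e where "e \<in> E" "e = {u, v}"
    using assms edge_eq unfolding directed_support_def roadmap_support_def by blast
  then show ?thesis by simp
qed

lemma unit_flow_rev:
  assumes "{u, v} \<in> E"
  shows "unit_flow v u e = - unit_flow u v e"
proof -
  have "u \<noteq> v" using edge_in_X assms by blast
  then show ?thesis
    by (rule_tac edge_cases[OF assms]) (simp_all add: unit_flow_def insert_commute)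
qed

lemma net_unit_flow:
  assumes "{u, v} \<in> E"
  shows "net (unit_flow u v) x = of_bool (x = u) - of_bool (x = v)"
proof -
  have "net (unit_flow u v) x = (\<Sum>e\<in>{{u, v}}. unit_flow u v e * (of_bool (tail e = x) - of_bool (head e = x)))"
    unfolding net_eq using assms finite_E
    by (intro sum.mono_neutral_right) (auto simp: unit_flow_def)
  with edge_in_X[OF assms] show ?thesis
    by (rule_tac edge_cases[OF assms]) (auto simp: unit_flow_def)
qed

section \<open>Downhill graphs are directed graphs of transportation problems\<close>

text \<open>
  Weak duality, with l as the certificate of optimality for the roadmap that sends one unit along
  each downhill edge.  Equality in it forces every optimal roadmap onto the downhill edges, so the
  support of the chosen one is maximal.
\<close>

lemma downhill_graph_is_directed_graph:
  assumes lip: "one_Lipschitz X d l" and D: "D = downhill_graph X d l" and "D \<noteq> {}"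
  obtains f where "f \<in> TP X" "\<exists>v\<in>X. f v \<noteq> 0" "is_directed_graph_of X d tail head f D"
proof -
  define drop where "drop e = l (tail e) - l (head e)" for e
  define p where "p e = (if \<bar>drop e\<bar> = len e then sgn (drop e) else 0)" for e
  have le: "q e * drop e \<le> \<bar>q e\<bar> * len e" if "e \<in> E" for q and e
  proof -
    have "q e * drop e \<le> \<bar>q e\<bar> * \<bar>drop e\<bar>" by (metis abs_ge_self abs_mult)
    also have "\<dots> \<le> \<bar>q e\<bar> * len e"
      using lip edge_ends[OF that] by (auto simp: one_Lipschitz_def drop_def intro: mult_left_mono)
    finally show ?thesis .
  qed
  have peq: "p e * drop e = \<bar>p e\<bar> * len e" if "e \<in> E" for e
    using len_pos[OF that] by (auto simp: p_def sgn_if)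
  have p0: "p e = 0 \<longleftrightarrow> \<bar>drop e\<bar> \<noteq> len e" if "e \<in> E" for e
    using len_pos[OF that] by (auto simp: p_def sgn_if)
  have roadmap_sum: "(\<Sum>e\<in>E. q e * drop e) = (\<Sum>v\<in>X. net p v * l v)"
    if "roadmap_for X d tail head (net p) q" for q
    using that sum_net_mult[of q l] by (simp add: roadmap_for_iff_net drop_def)
  have p_roadmap: "roadmap_for X d tail head (net p) p" by (simp add: roadmap_for_iff_net)
  have cost_p: "roadmap_cost X d tail head p = (\<Sum>v\<in>X. net p v * l v)"
    using roadmap_sum[OF p_roadmap] peq by (simp add: roadmap_cost_def)
  have p_opt: "optimal_roadmap_for X d tail head (net p) p"
    unfolding optimal_roadmap_for_def
  proof (intro conjI allI impI p_roadmap)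
    fix q assume "roadmap_for X d tail head (net p) q"
    then have "roadmap_cost X d tail head p = (\<Sum>e\<in>E. q e * drop e)"
      using cost_p roadmap_sum by simp
    then show "roadmap_cost X d tail head p \<le> roadmap_cost X d tail head q"
      using le by (simp add: roadmap_cost_def sum_mono)
  qed
  have supp: "roadmap_support X d q \<subseteq> roadmap_support X d p"
    if q: "optimal_roadmap_for X d tail head (net p) q" for q
  proof
    fix e assume "e \<in> roadmap_support X d q"
    then have e: "e \<in> E" "q e \<noteq> 0" by (auto simp: roadmap_support_def)
    have "roadmap_for X d tail head (net p) q" "roadmap_cost X d tail head q = roadmap_cost X d tail head p"
      using q p_opt by (auto simp: optimal_roadmap_for_def intro: antisym)
    then have "(\<Sum>e\<in>E. \<bar>q e\<bar> * len e) = (\<Sum>e\<in>E. q e * drop e)"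
      using roadmap_sum cost_p by (simp add: roadmap_cost_def)
    then have "(\<Sum>e\<in>E. \<bar>q e\<bar> * len e - q e * drop e) = 0" by (simp add: sum_subtractf)
    then have "\<bar>q e\<bar> * len e - q e * drop e = 0"
      using sum_nonneg_eq_0_iff[OF finite_E, of "\<lambda>e. \<bar>q e\<bar> * len e - q e * drop e"] le e by auto
    moreover have "0 \<le> \<bar>q e\<bar> * len e"
      using len_pos[OF e(1)] by (intro mult_nonneg_nonneg) linarith+
    ultimately have "\<bar>q e * drop e\<bar> = \<bar>q e\<bar> * len e" by linarith
    then have "\<bar>drop e\<bar> = len e" using e(2) by (simp add: abs_mult)
    then show "e \<in> roadmap_support X d p" using e p0 by (auto simp: roadmap_support_def)
  qed
  have D_eq: "D = directed_support X d tail head p"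
  proof -
    have "(u, v) \<in> D \<longleftrightarrow> (u, v) \<in> directed_support X d tail head p" if "{u, v} \<in> E" for u v
    proof -
      have "u \<noteq> v" using edge_in_X[OF that] by blast
      have "(u, v) \<in> D \<longleftrightarrow> \<bar>l u - l v\<bar> = d u v \<and> l u > l v"
        using that by (simp add: D downhill_graph_def)
      also have "\<dots> \<longleftrightarrow> unit_flow u v {u, v} * p {u, v} > 0"
        using that \<open>u \<noteq> v\<close>
        by (rule_tac edge_cases[OF that])
          (simp_all add: unit_flow_def p_def drop_def sgn_if commute abs_minus_commute)
      finally show ?thesis by (simp add: mem_directed_support_iff[OF that])
    qed
    moreover have "{u, v} \<in> E" if "(u, v) \<in> D" for u v
      using that by (auto simp: D downhill_graph_def)
    ultimately show ?thesis using mem_directed_support_edge by auto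
  qed
  have "\<exists>v\<in>X. net p v \<noteq> 0"
  proof (rule ccontr)
    assume "\<not> (\<exists>v\<in>X. net p v \<noteq> 0)"
    then have "(\<Sum>e\<in>E. \<bar>p e\<bar> * len e) = 0" using cost_p by (simp add: roadmap_cost_def)
    then have "\<bar>p e\<bar> * len e = 0" if "e \<in> E" for e
      using that len_pos sum_nonneg_eq_0_iff[OF finite_E, of "\<lambda>e. \<bar>p e\<bar> * len e"] by fastforce
    then have "p e = 0" if "e \<in> E" for e using that len_pos by fastforce
    then have "D = {}" by (auto simp: D_eq directed_support_def roadmap_support_def)
    with \<open>D \<noteq> {}\<close> show False ..
  qed
  moreover have "net p \<in> TP X" using sum_net_mult[of p "\<lambda>_. 1"] by (simp add: TP_def)
  moreover have "is_directed_graph_of X d tail head (net p) D"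
    unfolding is_directed_graph_of_def
    by (intro exI[of _ p] conjI allI impI p_opt D_eq) (rule supp)
  ultimately show thesis using that[of "net p"] by simp
qed

section \<open>Rerouting an optimal roadmap\<close>

lemma cost_deriv_add_le: "cost_deriv p (\<lambda>e. q e + r e) \<le> cost_deriv p q + cost_deriv p r"
  unfolding cost_deriv_def sum.distrib[symmetric]
proof (rule sum_mono)
  fix e assume "e \<in> E"
  then have "\<bar>q e + r e\<bar> * len e \<le> (\<bar>q e\<bar> + \<bar>r e\<bar>) * len e"
    using len_pos[of e] by (intro mult_right_mono) auto
  then show "(if p e = 0 then \<bar>q e + r e\<bar> else sgn (p e) * (q e + r e)) * len e
      \<le> (if p e = 0 then \<bar>q e\<bar> else sgn (p e) * q e) * len e
        + (if p e = 0 then \<bar>r e\<bar> else sgn (p e) * r e) * len e"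
    by (auto simp: algebra_simps)
qed

lemma cost_deriv_zero: "cost_deriv p (\<lambda>_. 0) = 0"
  unfolding cost_deriv_def by (intro sum.neutral ballI) simp

text \<open>
  The cost is piecewise linear, so the first-order expansion is exact until, on some edge where p
  is nonzero, p + t * q changes sign.
\<close>

lemma cost_along_ray:
  obtains t where "0 < t" "roadmap_cost X d tail head (\<lambda>e. p e + t * q e) =
    roadmap_cost X d tail head p + t * cost_deriv p q"
proof -
  have "eventually (\<lambda>t. \<bar>t * q e\<bar> < \<bar>p e\<bar>) (at_right 0)" if "p e \<noteq> 0" for e
  proof -
    have "((\<lambda>t. \<bar>t * q e\<bar>) \<longlongrightarrow> \<bar>0 * q e\<bar>) (at_right 0)" by (intro tendsto_intros)
    then show ?thesis using that by (intro order_tendstoD(2)) auto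
  qed
  then have "eventually (\<lambda>t. \<forall>e\<in>E. p e \<noteq> 0 \<longrightarrow> \<bar>t * q e\<bar> < \<bar>p e\<bar>) (at_right 0)"
    using finite_E by (intro eventually_ball_finite) auto
  then have "eventually (\<lambda>t. 0 < t \<and> (\<forall>e\<in>E. p e \<noteq> 0 \<longrightarrow> \<bar>t * q e\<bar> < \<bar>p e\<bar>)) (at_right 0)"
    using eventually_at_right_less[of 0] by eventually_elim simp
  then have "\<exists>t>0. \<forall>e\<in>E. p e \<noteq> 0 \<longrightarrow> \<bar>t * q e\<bar> < \<bar>p e\<bar>"
    by (rule eventually_happens'[OF trivial_limit_at_right_real])
  then obtain t :: real where t: "0 < t" "\<And>e. e \<in> E \<Longrightarrow> p e \<noteq> 0 \<Longrightarrow> \<bar>t * q e\<bar> < \<bar>p e\<bar>"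
    by blast
  have "\<bar>p e + t * q e\<bar> * len e =
      \<bar>p e\<bar> * len e + t * ((if p e = 0 then \<bar>q e\<bar> else sgn (p e) * q e) * len e)" if "e \<in> E" for e
  proof -
    have "\<bar>p e + t * q e\<bar> = \<bar>p e\<bar> + t * (if p e = 0 then \<bar>q e\<bar> else sgn (p e) * q e)"
    proof (cases "p e = 0")
      case True
      then show ?thesis using t(1) by (simp add: abs_mult)
    next
      case False
      then have "\<bar>t * q e\<bar> < \<bar>p e\<bar>" using t(2)[OF that] by blast
      then have "\<bar>p e + t * q e\<bar> = \<bar>p e\<bar> + sgn (p e) * (t * q e)"
        using False unfolding sgn_if by (cases "p e > 0") simp_all
      then show ?thesis using False by simp
    qed
    then show ?thesis by (simp only: distrib_right mult.assoc)
  qed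
  then have "roadmap_cost X d tail head (\<lambda>e. p e + t * q e) =
      roadmap_cost X d tail head p + t * cost_deriv p q"
    by (simp add: roadmap_cost_def cost_deriv_def sum.distrib sum_distrib_left)
  then show thesis by (rule that[OF t(1)])
qed

text \<open>
  A unit sent from u to v against flow of p cancels some of it and saves the length of the edge.
\<close>

lemma cost_deriv_unit_flow:
  assumes "{u, v} \<in> E"
  shows "cost_deriv p (unit_flow u v) =
    (if (v, u) \<in> directed_support X d tail head p then - d u v else d u v)"
proof -
  let ?e = "{u, v}"
  have "cost_deriv p (unit_flow u v) = (\<Sum>e\<in>{?e}.
      (if p e = 0 then \<bar>unit_flow u v e\<bar> else sgn (p e) * unit_flow u v e) * len e)"
    unfolding cost_deriv_def using assms finite_E
    by (intro sum.mono_neutral_right) (auto simp: unit_flow_def)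
  also have "\<dots> = (if unit_flow u v ?e * p ?e < 0 then - d u v else d u v)"
    using len_edge[OF assms] by (auto simp: unit_flow_def sgn_if)
  also have "unit_flow u v ?e * p ?e < 0 \<longleftrightarrow> (v, u) \<in> directed_support X d tail head p"
    using mem_directed_support_iff[of v u p] assms unit_flow_rev[OF assms, of ?e]
    by (simp add: insert_commute)
  finally show ?thesis .
qed

text \<open>
  This is where the canonical graph enters: a pair that is not an edge splits at an intermediate
  point w into two strictly shorter pairs whose distances add up, so every distance is realised
  along edges.  The induction is on the rank of d u v among the finitely many distances.
\<close>

lemma flow_between:
  assumes "u \<in> X" "v \<in> X"
  shows "\<exists>q. (\<forall>x. net q x = of_bool (x = u) - of_bool (x = v)) \<and> cost_deriv p q \<le> d u v"
  using assms
proof (induction "card {(x, y) \<in> X \<times> X. d x y < d u v}" arbitrary: u v rule: less_induct)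
  case less
  have smaller: "card {(x, y) \<in> X \<times> X. d x y < d a b} < card {(x, y) \<in> X \<times> X. d x y < d u v}"
    if "d a b < d u v" "a \<in> X" "b \<in> X" for a b
    using that finite_X by (intro psubset_card_mono) (auto intro: finite_subset[of _ "X \<times> X"])
  consider "u = v" | "{u, v} \<in> E" | w where "u \<noteq> v" "w \<in> X" "w \<notin> {u, v}" "d u w + d w v = d u v"
    using less.prems by (auto simp: canonical_edges_def)
  then show ?case
  proof cases
    case 1
    then have "(\<forall>x. net (\<lambda>_. 0) x = of_bool (x = u) - of_bool (x = v)) \<and> cost_deriv p (\<lambda>_. 0) \<le> d u v"
      by (simp add: net_def cost_deriv_zero)
    then show ?thesis by blast
  next
    case 2
    have "cost_deriv p (unit_flow u v) \<le> d u v"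
      using cost_deriv_unit_flow[OF 2, of p] nonneg[of u v] by auto
    then show ?thesis using net_unit_flow[OF 2] by blast
  next
    case 3
    have "0 < d u w" "0 < d w v"
      using 3 less.prems by (auto intro!: mdist_pos_less)
    with 3 have "d u w < d u v" "d w v < d u v" by linarith+
    then obtain q r where
      "\<forall>x. net q x = of_bool (x = u) - of_bool (x = w)" "cost_deriv p q \<le> d u w"
      "\<forall>x. net r x = of_bool (x = w) - of_bool (x = v)" "cost_deriv p r \<le> d w v"
      using less.hyps[OF smaller, of u w] less.hyps[OF smaller, of w v] less.prems \<open>w \<in> X\<close> by blast
    then have "(\<forall>x. net (\<lambda>e. q e + r e) x = of_bool (x = u) - of_bool (x = v)) \<and>
        cost_deriv p (\<lambda>e. q e + r e) \<le> d u v"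
      using cost_deriv_add_le[of p q r] 3 by (auto simp: net_add)
    then show ?thesis by blast
  qed
qed

text \<open>
  Bounding l u - l v by this cost for all u and v makes l 1-Lipschitz and, since both directions
  of a pair in D are bounded, makes l drop by exactly the distance along D.
\<close>

definition residual_cost :: "('a set \<Rightarrow> real) \<Rightarrow> 'a \<Rightarrow> 'a \<Rightarrow> real" where
  "residual_cost p u v = (if (v, u) \<in> directed_support X d tail head p then - d u v else d u v)"

text \<open>
  Only an upper bound holds: steps of the walk may cancel on an edge, and a step that is not an
  edge is replaced by a flow that may itself run against p.
\<close>

lemma flow_along_walk:
  assumes "xs \<in> walks X u v"
  shows "\<exists>q. (\<forall>x. net q x = of_bool (x = u) - of_bool (x = v)) \<and>
    cost_deriv p q \<le> walk_cost (residual_cost p) xs"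
  using assms
proof (induction xs arbitrary: u)
  case Nil
  then show ?case by (simp add: walks_def)
next
  case (Cons a xs)
  then have a: "a = u" "u \<in> X" by (auto simp: walks_def)
  show ?case
  proof (cases "xs = []")
    case True
    have "u = v" using Cons True by (auto simp: walks_def)
    then show ?thesis using True
      by (intro exI[of _ "\<lambda>_. 0"]) (simp add: net_def cost_deriv_zero)
  next
    case False
    let ?w = "hd xs"
    have xs: "xs \<in> walks X ?w v" using Cons False by (auto simp: walks_def)
    then have w: "?w \<in> X" using False by (auto simp: walks_def)
    obtain q where q: "\<forall>x. net q x = of_bool (x = ?w) - of_bool (x = v)"
      "cost_deriv p q \<le> walk_cost (residual_cost p) xs"
      using Cons.IH[OF xs] by blast
    have "\<exists>r. (\<forall>x. net r x = of_bool (x = u) - of_bool (x = ?w)) \<and> cost_deriv p r \<le> residual_cost p u ?w"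
    proof (cases "(?w, u) \<in> directed_support X d tail head p")
      case True
      then have "{u, ?w} \<in> E"
        using mem_directed_support_edge[of ?w u p] by (simp add: insert_commute)
      then show ?thesis
        using True
        by (intro exI[of _ "unit_flow u ?w"])
          (simp add: net_unit_flow cost_deriv_unit_flow residual_cost_def)
    next
      case False
      then show ?thesis using flow_between[OF a(2) w] by (simp add: residual_cost_def)
    qed
    then obtain r where r: "\<forall>x. net r x = of_bool (x = u) - of_bool (x = ?w)"
      "cost_deriv p r \<le> residual_cost p u ?w" by blast
    show ?thesis
      using q r a cost_deriv_add_le[of p r q] False
      by (intro exI[of _ "\<lambda>e. r e + q e"]) (auto simp: net_add walk_cost_Cons)
  qed
qed

section \<open>Directed graphs of transportation problems are downhill graphs\<close>

lemma cost_deriv_circulation_nonneg: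
  assumes opt: "optimal_roadmap_for X d tail head f p" and circ: "\<And>v. v \<in> X \<Longrightarrow> net q v = 0"
  shows "0 \<le> cost_deriv p q"
proof -
  obtain t where t: "0 < t" "roadmap_cost X d tail head (\<lambda>e. p e + t * q e) =
      roadmap_cost X d tail head p + t * cost_deriv p q"
    using cost_along_ray by blast
  have "roadmap_for X d tail head f (\<lambda>e. p e + t * q e)"
    using opt circ by (auto simp: optimal_roadmap_for_def roadmap_for_iff_net net_add net_scale)
  then have "0 \<le> t * cost_deriv p q" using opt t(2) unfolding optimal_roadmap_for_def by fastforce
  then show ?thesis using t(1) by (simp add: zero_le_mult_iff)
qed

text \<open>
  Moving p along such a q gives another optimal roadmap, whose support contains every
  edge of q on which p vanishes.
\<close>

lemma null_circulation_within_support: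
  assumes opt: "optimal_roadmap_for X d tail head f p"
    and max: "\<And>q. optimal_roadmap_for X d tail head f q \<Longrightarrow> roadmap_support X d q \<subseteq> roadmap_support X d p"
    and circ: "\<And>v. v \<in> X \<Longrightarrow> net q v = 0" and le: "cost_deriv p q \<le> 0"
    and e: "e \<in> E" "p e = 0"
  shows "q e = 0"
proof -
  obtain t where t: "0 < t" "roadmap_cost X d tail head (\<lambda>e. p e + t * q e) =
      roadmap_cost X d tail head p + t * cost_deriv p q"
    using cost_along_ray by blast
  have "roadmap_cost X d tail head (\<lambda>e. p e + t * q e) \<le> roadmap_cost X d tail head p"
    using t le by (simp add: mult_nonneg_nonpos)
  moreover have "roadmap_for X d tail head f (\<lambda>e. p e + t * q e)"
    using opt circ by (auto simp: optimal_roadmap_for_def roadmap_for_iff_net net_add net_scale)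
  ultimately have "optimal_roadmap_for X d tail head f (\<lambda>e. p e + t * q e)"
    using opt unfolding optimal_roadmap_for_def by (meson order_trans)
  from max[OF this] e t(1) show ?thesis by (auto simp: roadmap_support_def)
qed

text \<open>
  The delicate point is that a closed walk through an unused edge {u, v} has positive cost, because
  its flow may cross {u, v} back and forth with total 0.  But then the walk pays d u v for each of
  the two crossings, while what remains of its flow without them is a circulation and therefore
  does not cost less than 0.
\<close>

lemma directed_graph_is_downhill_graph:
  assumes dir: "directed_subgraph E D" and "is_directed_graph_of X d tail head f D"
  obtains l where "one_Lipschitz X d l" "D = downhill_graph X d l"
proof -
  obtain p where opt: "optimal_roadmap_for X d tail head f p"
    and max: "\<And>q. optimal_roadmap_for X d tail head f q \<Longrightarrow> roadmap_support X d q \<subseteq> roadmap_support X d p"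
    and D: "D = directed_support X d tail head p"
    using assms(2) unfolding is_directed_graph_of_def by blast
  define S where "S = {(u, v). {u, v} \<in> E \<and> p {u, v} = 0}"
  have "0 \<le> walk_cost (residual_cost p) xs" if xs: "xs \<in> walks X u u" for u xs
  proof -
    obtain q where "\<forall>x. net q x = 0" "cost_deriv p q \<le> walk_cost (residual_cost p) xs"
      using flow_along_walk[OF xs, of p] by auto
    then show ?thesis using cost_deriv_circulation_nonneg[OF opt, of q] by simp
  qed
  moreover have "0 < residual_cost p u v + walk_cost (residual_cost p) xs"
    if "(u, v) \<in> S" and xs: "xs \<in> walks X v u" for u v xs
  proof (rule ccontr)
    assume neg: "\<not> ?thesis"
    have e: "{u, v} \<in> E" "p {u, v} = 0" using that(1) by (auto simp: S_def)
    have pos: "0 < d u v" using edge_in_X[OF e(1)] mdist_pos_less by blast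
    have res: "residual_cost p u v = d u v"
      using e mem_directed_support_iff[of v u p] by (simp add: residual_cost_def insert_commute)
    obtain q where q: "\<forall>x. net q x = of_bool (x = v) - of_bool (x = u)"
      "cost_deriv p q \<le> walk_cost (residual_cost p) xs"
      using flow_along_walk[OF xs] by blast
    define r where "r e = q e + unit_flow u v e" for e
    have circ: "net r x = 0" for x
      using q(1) net_unit_flow[OF e(1), of x] unfolding r_def net_add by simp
    have unit: "cost_deriv p (unit_flow u v) = d u v"
      using cost_deriv_unit_flow[OF e(1), of p] res by (simp add: residual_cost_def)
    have "cost_deriv p r \<le> cost_deriv p q + d u v"
      using cost_deriv_add_le[of p q "unit_flow u v"] unit by (simp add: r_def[abs_def])
    with q(2) neg res have "cost_deriv p r \<le> 0" by linarith
    then have "r {u, v} = 0" using null_circulation_within_support[OF opt max circ _ e] by blast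
    \<comment> \<open>As r vanishes on {u, v}, q sends exactly one unit from v to u there, at a cost of d u v on
      top of that of r.\<close>
    then have "cost_deriv p q = cost_deriv p r + cost_deriv p (unit_flow u v)"
      unfolding cost_deriv_def sum.distrib[symmetric]
      by (intro sum.cong refl) (auto simp: r_def unit_flow_def e(2) split: if_splits)
    moreover have "0 \<le> cost_deriv p r" using cost_deriv_circulation_nonneg[OF opt circ] .
    ultimately show False using unit q(2) neg res pos by linarith
  qed
  ultimately obtain l where
    l: "\<And>u v. u \<in> X \<Longrightarrow> v \<in> X \<Longrightarrow> l u - l v \<le> residual_cost p u v" and
    l_strict: "\<And>u v. u \<in> X \<Longrightarrow> v \<in> X \<Longrightarrow> (u, v) \<in> S \<Longrightarrow> l u - l v < residual_cost p u v"
    using strict_potential_exists[OF finite_X, of "residual_cost p" S] by blast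
  have res_le: "residual_cost p u v \<le> d u v" for u v
    using nonneg[of u v] by (simp add: residual_cost_def)
  have lip: "l u - l v \<le> d u v" if "u \<in> X" "v \<in> X" for u v
    using l[OF that] res_le[of u v] by linarith
  have "one_Lipschitz X d l"
    unfolding one_Lipschitz_def using lip commute by (metis abs_le_iff minus_diff_eq)
  moreover have D_drop: "l u - l v = d u v \<and> {u, v} \<in> E" if "(u, v) \<in> D" for u v
  proof -
    have e: "{u, v} \<in> E" using that dir by (auto simp: directed_subgraph_def)
    then have "u \<in> X" "v \<in> X" using edge_in_X by auto
    then show ?thesis
      using e l[of v u] lip[of u v] that by (auto simp: residual_cost_def D commute)
  qed
  have "D = downhill_graph X d l"
  proof (intro set_eqI iffI; clarify)
    fix u v assume "(u, v) \<in> D"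
    then have e: "{u, v} \<in> E" and drop: "l u - l v = d u v" using D_drop by auto
    then have "0 < d u v" using edge_in_X[OF e] mdist_pos_less by blast
    with e drop show "(u, v) \<in> downhill_graph X d l"
      by (simp add: downhill_graph_def)
  next
    fix u v assume "(u, v) \<in> downhill_graph X d l"
    then have e: "{u, v} \<in> E" and drop: "l u - l v = d u v" "l u > l v"
      by (auto simp: downhill_graph_def)
    have uv: "u \<in> X" "v \<in> X" using edge_in_X[OF e] by auto
    have "p {u, v} \<noteq> 0"
      using l_strict[OF uv] res_le[of u v] drop(1) e by (auto simp: S_def)
    then have "unit_flow u v {u, v} * p {u, v} \<noteq> 0" by (simp add: unit_flow_def)
    then have "(u, v) \<in> D \<or> (v, u) \<in> D"
      unfolding D using mem_directed_support_iff[OF e, of p] mem_directed_support_iff[of v u p] e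
        unit_flow_rev[OF e, of "{u, v}"] by (auto simp: insert_commute)
    then show "(u, v) \<in> D" using D_drop[of v u] drop(2) nonneg[of v u] by force
  qed
  ultimately show thesis using that by blast
qed

end

theorem theorem2p3:
  fixes X :: "'a set" and d :: "'a \<Rightarrow> 'a \<Rightarrow> real"
    and tail head :: "'a set \<Rightarrow> 'a" and D :: "('a \<times> 'a) set"
  assumes "Metric_space X d" and "finite X"
    and "orientation (canonical_edges X d) tail head"
    and "directed_subgraph (canonical_edges X d) D" and "D \<noteq> {}"
  shows "(\<exists>l. one_Lipschitz X d l \<and> D = downhill_graph X d l) \<longleftrightarrow>
         (\<exists>f\<in>TP X. (\<exists>v\<in>X. f v \<noteq> 0) \<and> is_directed_graph_of X d tail head f D)"
proof -
  interpret oriented_canonical_graph X d tail head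
    using assms by (simp add: oriented_canonical_graph_def oriented_canonical_graph_axioms_def)
  show ?thesis
    using downhill_graph_is_directed_graph[OF _ _ assms(5)]
      directed_graph_is_downhill_graph[OF assms(4)] by metis
qed

end
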